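(* Let $p<q$ be square-free integers $\ge 2$ with $p\equiv q\equiv 1\pmod 4$, put $r=pq/\gcd(p,q)^2$ and assume $p<q<r$. Let $K=\mathbb{Q}(\sqrt p,\sqrt q)$ (where either $\gcd(p,q)\equiv 1\pmod 4$ or $\gcd(p,q)\equiv 3\pmod 4$). Let $m,t,\kappa$ be positive integers and let $$I_4=\left[\frac{m\kappa}{t}+2\frac{\sqrt m}{\sqrt t},\ \frac{m\kappa}{t-1}-2\frac{\sqrt m}{\sqrt{t-1}}\right]\quad(t>1),$$ where the right endpoint is replaced by $\infty$ when $t=1$. If $m\le\min\{\frac{r}{16(\kappa\sqrt r+1)},\,p,\,q\}$ and $\sqrt p,\sqrt q\in I_4$, then not all elements of $m\mathcal{O}_K^+$ are sums of squares of elements of $\mathcal{O}_K$. Moreover, the interval $I_4$ is non-empty for $m\ge\frac{t(t-1)\left(2t-1+2\sqrt{t(t-1)}\right)}{\kappa^2}$.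
   Context: $\mathcal{O}_K$ is the ring of integers of $K$, $\mathcal{O}_K^+$ is the set of its totally positive elements (all four real embeddings positive), and $m\mathcal{O}_K^+=\{m\alpha:\alpha\in\mathcal{O}_K^+\}$. A sum of squares in $\mathcal{O}_K$ is a finite sum $\sum_i\alpha_i^2$ with $\alpha_i\in\mathcal{O}_K$.
   Formalization: The non-emptiness bound is corrected to m ≥ 4t(t−1)(2t−1+2√(t(t−1)))/κ²; as printed, without the factor 4, it fails for m=12, t=2, κ=1, where I_4 = [6+2√6, 12−2√12] is empty. *)

theory Defs
  imports
    Complex_Main
    "HOL-Computational_Algebra.Computational_Algebra"
    "HOL-Algebra.Generated_Fields"
    "HOL-Algebra.Algebraic_Closure_Type"
begin

abbreviation real_ring :: "real ring" where
  "real_ring \<equiv> ring_of_type_algebra"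

definition biquadratic_field :: "nat \<Rightarrow> nat \<Rightarrow> real set" where
  "biquadratic_field p q = generate_field real_ring {sqrt (real p), sqrt (real q)}"

definition ring_of_integers :: "real set \<Rightarrow> real set" where
  "ring_of_integers K = {x \<in> K. algebraic_int x}"

(* ring_hom is a set of total functions, so embeddings are represented by functions that are
   arbitrary outside K; only their values on K are ever used. *)
definition real_embeddings :: "real set \<Rightarrow> (real \<Rightarrow> real) set" where
  "real_embeddings K = ring_hom (real_ring\<lparr>carrier := K\<rparr>) real_ring"

definition totally_positive_integers :: "real set \<Rightarrow> real set" where
  "totally_positive_integers K =
     {x \<in> ring_of_integers K. \<forall>\<sigma>\<in>real_embeddings K. \<sigma> x > 0}"

definition sums_of_squares :: "real set \<Rightarrow> real set" where
  "sums_of_squares A = {\<Sum>x\<leftarrow>xs. x\<^sup>2 | xs. set xs \<subseteq> A}"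

definition I4 :: "nat \<Rightarrow> nat \<Rightarrow> nat \<Rightarrow> real set" where
  "I4 m t \<kappa> =
     (let a = real m * real \<kappa> / real t + 2 * (sqrt (real m) / sqrt (real t));
          b = real m * real \<kappa> / (real t - 1) - 2 * (sqrt (real m) / sqrt (real t - 1))
      in if t = 1 then {a..} else {a..b})"

(* For t > 1 the interval I4 is non-empty exactly when
     m >= 4 * t (t - 1) (2 t - 1 + 2 sqrt (t (t - 1))) / kappa^2.
   The published bound omits the factor 4 and is then not sufficient, as the following
   instance shows. *)
lemma I4_empty_above_bound_without_factor_4:
  fixes m t \<kappa> :: nat
  defines "m \<equiv> 12" and "t \<equiv> 2" and "\<kappa> \<equiv> 1"
  shows "real t * (real t - 1) * (2 * real t - 1 + 2 * sqrt (real t * (real t - 1)))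
           / (real \<kappa>)\<^sup>2 \<le> real m"
    and "I4 m t \<kappa> = {}"
proof -
  have "sqrt 2 \<le> 3 / 2"
    by (rule real_le_lsqrt) (simp_all add: power2_eq_square)
  then show "real t * (real t - 1) * (2 * real t - 1 + 2 * sqrt (real t * (real t - 1)))
           / (real \<kappa>)\<^sup>2 \<le> real m"
    by (simp add: m_def t_def \<kappa>_def)
  have "sqrt 12 > (3::real)"
    by (rule real_less_rsqrt) simp
  moreover have "sqrt 12 / sqrt 2 \<ge> (0::real)" by simp
  ultimately have "12 - 2 * sqrt 12 < 6 + 2 * (sqrt 12 / sqrt (2::real))"
    by linarith
  then show "I4 m t \<kappa> = {}"
    by (simp add: I4_def m_def t_def \<kappa>_def Let_def)
qed

end

(* Let s = sqrt p and let c be the least integer > kappa s with c = kappa (mod 2). Then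
   alpha = (c + kappa s)/2 is a totally positive integer of K, and m alpha is not a sum of squares.
   Suppose m alpha = sum_i a_i^2 with a_i = (x_i + y_i sqrt p + z_i sqrt q + w_i sqrt r)/4. The
   bound on m forces all w_i = 0, and as y_i = w_i (mod 2), every y_i is even. Put
   N = sum_i (y_i/2)^2. Comparing the coefficients of 1 and sqrt p and applying the Cauchy-Schwarz
   inequality to sum_i (x_i/2 - s y_i/2)(y_i/2) = m kappa - s N gives
   (s N - m kappa)^2 < 4 m N, since c - kappa s < 2. But the interval I4 consists of numbers that
   are at least m kappa/N + 2 sqrt(m/N) for N >= t and at most m kappa/N - 2 sqrt(m/N) for
   0 < N < t. *)

theory Submission
  imports Defs
begin

text \<open>An integral basis of K would depend on the residue of gcd(p, q) modulo 4, so none is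
  computed. The only facts used about an algebraic integer of K are that its coordinates at 1, sqrt
  p and sqrt r are quarters of integers x, y, w and that these have equal parity. Both come from
  quadratic subfields: the trace to Q(sqrt p) is (x + y sqrt p)/2, its norm (x^2 - p y^2)/4 is an
  integer, and p is odd, so x = y (mod 2); in the same way x = w (mod 2) from Q(sqrt r). A nonzero
  w_i would contribute at least r/16 to the rational part of m alpha. That part is m c/2 < m (kappa
  s + 2)/2 \<le> m (kappa sqrt r + 1) \<le> r/16, which is where the 16 in the bound on m comes
  from. Evenness of the y_i is what makes N an integer. This is essential, because the contradiction
  uses that no integer lies strictly between t - 1 and t.\<close>

section \<open>Squarefree numbers, square roots and denominators\<close>

lemma rational_square_integer:
  fixes x :: real
  assumes "x \<in> \<rat>" and "x\<^sup>2 \<in> \<int>"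
  shows "x \<in> \<int>"
proof (rule rational_algebraic_int_is_int)
  show "algebraic_int x"
    by (rule algebraic_int_root[where p = "monom 1 2" and y = "x\<^sup>2"])
       (use assms in \<open>auto simp: poly_monom degree_monom_eq int_imp_algebraic_int\<close>)
qed fact

lemma squarefree_dvd_square:
  fixes p n :: nat
  assumes "squarefree p" and "p dvd n\<^sup>2"
  shows "p dvd n"
proof -
  have "p \<noteq> 0"
    using assms(1) by (metis not_squarefree_0)
  define d where "d = gcd p n"
  obtain a b where p: "p = a * d" and n: "n = b * d" and "coprime a b"
    using gcd_coprime_exists[of p n] \<open>p \<noteq> 0\<close> unfolding d_def by auto
  have "d * a dvd d * (d * b\<^sup>2)"
    using assms(2) unfolding p n by (simp add: power2_eq_square mult_ac)
  then have "a dvd d * b\<^sup>2"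
    using \<open>p \<noteq> 0\<close> p by simp
  then have "a dvd d"
    using \<open>coprime a b\<close> by (simp add: coprime_dvd_mult_left_iff)
  then have "a\<^sup>2 dvd p"
    unfolding p power2_eq_square by (rule mult_dvd_mono[OF dvd_refl])
  then have "a = 1"
    using assms(1) squarefreeD[of p a] by simp
  then show ?thesis
    using p n by simp
qed

lemma squarefree_dvd_square_imp_dvd:
  fixes p :: nat and k :: int
  assumes "squarefree p" and "int p dvd k\<^sup>2"
  shows "int p dvd k"
proof -
  have "p dvd (nat \<bar>k\<bar>) ^ 2"
    using assms(2) by (metis int_dvd_int_iff of_nat_power power2_abs nat_0_le abs_ge_zero)
  then have "p dvd nat \<bar>k\<bar>"
    using squarefree_dvd_square assms(1) by blast
  then show ?thesis
    by auto
qed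

lemma sqrt_squarefree_irrational:
  assumes "squarefree p" and "p > 1"
  shows "sqrt (real p) \<notin> \<rat>"
proof
  assume "sqrt (real p) \<in> \<rat>"
  then have "sqrt (real p) \<in> \<int>"
    by (rule rational_square_integer) simp
  then obtain k where k: "sqrt (real p) = of_int k"
    by (elim Ints_cases)
  then have "real p = of_int (k\<^sup>2)"
    by (metis of_int_power real_sqrt_pow2 of_nat_0_le_iff)
  then have pk: "int p = k\<^sup>2"
    by linarith
  then have "int p dvd k"
    using squarefree_dvd_square_imp_dvd[OF assms(1)] by simp
  then have "k\<^sup>2 dvd k"
    using pk by simp
  then have "\<bar>k\<bar> = 1 \<or> k = 0"
    by (auto simp: power2_eq_square abs_mult dest: zdvd_mult_cancel1)
  then show False
    using pk assms(2) by (auto simp: power2_eq_square abs_if split: if_splits)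
qed

text \<open>A squarefree \<open>p\<close> cannot absorb a squared denominator of \<open>b\<close>:
  first \<open>b * real p\<close> is an integer \<open>k\<close>, then \<open>k^2 = n p\<close>
  makes \<open>p\<close> divide \<open>k\<close>. This clears the denominator of a coefficient at a
  square root once a norm is known to be integral.\<close>

lemma squarefree_mult_square_integer:
  fixes b :: real
  assumes p: "squarefree p" "p > 0" and b: "b \<in> \<rat>" and int: "b\<^sup>2 * real p \<in> \<int>"
  shows "b \<in> \<int>"
proof -
  have "(b * real p)\<^sup>2 = (b\<^sup>2 * real p) * real p"
    by (simp add: power2_eq_square)
  then have "(b * real p)\<^sup>2 \<in> \<int>"
    using int by simp
  then have "b * real p \<in> \<int>"
    using b by (auto intro: rational_square_integer[of "b * real p"])
  then obtain k where k: "b * real p = of_int k"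
    by (elim Ints_cases)
  obtain n where n: "b\<^sup>2 * real p = of_int n"
    using int by (elim Ints_cases)
  have "(of_int (k\<^sup>2) :: real) = of_int (n * int p)"
    unfolding of_int_power k[symmetric] of_int_mult n[symmetric] by (simp add: power2_eq_square)
  then have "k\<^sup>2 = n * int p"
    by (simp only: of_int_eq_iff)
  then have "int p dvd k"
    using squarefree_dvd_square_imp_dvd[OF p(1)] by simp
  then obtain j where "k = int p * j" ..
  then have "b = of_int j"
    using k p by simp
  then show ?thesis
    by simp
qed

section \<open>Coordinates, independence and conjugation in the biquadratic field\<close>

text \<open>With \<open>g = gcd p q\<close>, \<open>p = g u\<close>, \<open>q = g v\<close> and \<open>r = u v\<close>, the intended \<open>s1\<close>, \<open>s2\<close>, \<open>s3\<close> are the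
  square roots of \<open>p\<close>, \<open>q\<close>, \<open>r\<close>. In this form the assumptions are symmetric in the three roots.\<close>

locale biquadratic =
  fixes g u v :: nat and s1 s2 s3 :: real
  assumes pos: "g > 0" "u > 0" "v > 0"
    and square: "s1 * s1 = real (g * u)" "s2 * s2 = real (g * v)" "s3 * s3 = real (u * v)"
    and cross: "s1 * s2 = real g * s3" "s1 * s3 = real u * s2" "s2 * s3 = real v * s1"
    and irrational: "s1 \<notin> \<rat>" "s2 \<notin> \<rat>" "s3 \<notin> \<rat>"
begin

text \<open>Together with \<open>rotate\<close>, this carries a result about \<open>s1\<close> over
  to the other two roots, so that each argument is made for one root only.\<close>

lemma swap12: "biquadratic g v u s2 s1 s3"
  by unfold_locales (use pos square cross irrational in \<open>simp_all add: mult.commute\<close>)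

lemma rotate: "biquadratic u v g s3 s1 s2"
  by unfold_locales (use pos square cross irrational in \<open>simp_all add: mult.commute\<close>)

definition comb :: "real \<Rightarrow> real \<Rightarrow> real \<Rightarrow> real \<Rightarrow> real" where
  "comb a b c d = a + b * s1 + c * s2 + d * s3"

definition combs :: "real set \<Rightarrow> real set" where
  "combs R = {comb a b c d | a b c d. a \<in> R \<and> b \<in> R \<and> c \<in> R \<and> d \<in> R}"

lemma combsI: "a \<in> R \<Longrightarrow> b \<in> R \<Longrightarrow> c \<in> R \<Longrightarrow> d \<in> R \<Longrightarrow> comb a b c d \<in> combs R"
  by (auto simp: combs_def)

lemma combsE:
  assumes "x \<in> combs R"
  obtains a b c d where "x = comb a b c d" "a \<in> R" "b \<in> R" "c \<in> R" "d \<in> R"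
  using assms by (auto simp: combs_def)

lemma comb_add: "comb a b c d + comb a' b' c' d' = comb (a + a') (b + b') (c + c') (d + d')"
  by (simp add: comb_def algebra_simps)

lemma comb_mult:
  "comb a b c d * comb a' b' c' d' =
     comb (a * a' + b * b' * real (g * u) + c * c' * real (g * v) + d * d' * real (u * v))
          (a * b' + b * a' + (c * d' + d * c') * real v)
          (a * c' + c * a' + (b * d' + d * b') * real u)
          (a * d' + d * a' + (b * c' + c * b') * real g)"
proof -
  have "comb a b c d * comb a' b' c' d' =
     a * a' + b * b' * (s1 * s1) + c * c' * (s2 * s2) + d * d' * (s3 * s3)
     + (a * b' + b * a') * s1 + (a * c' + c * a') * s2 + (a * d' + d * a') * s3
     + (b * c' + c * b') * (s1 * s2) + (b * d' + d * b') * (s1 * s3) + (c * d' + d * c') * (s2 * s3)"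
    by (simp add: comb_def algebra_simps)
  then show ?thesis
    unfolding square cross by (simp add: comb_def algebra_simps)
qed

text \<open>Squaring a + b s1 = -(c s2 + d s3) leaves \<open>s1\<close> as the only root, since s2
  s3 = v s1. Its coefficient must vanish because \<open>s1\<close> is irrational.\<close>

lemma rational_comb_eq_0_aux:
  assumes "a \<in> \<rat>" "b \<in> \<rat>" "c \<in> \<rat>" "d \<in> \<rat>" and "comb a b c d = 0"
  shows "a * b = c * d * real v"
proof (rule ccontr)
  assume neq: "a * b \<noteq> c * d * real v"
  have "a + b * s1 = - (c * s2 + d * s3)"
    using assms(5) by (simp add: comb_def)
  then have "(a + b * s1) * (a + b * s1) = (c * s2 + d * s3) * (c * s2 + d * s3)"
    by (simp only: minus_mult_minus)
  then have "a * a + b * b * (s1 * s1) + 2 * (a * b) * s1 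
      = c * c * (s2 * s2) + d * d * (s3 * s3) + 2 * c * d * (s2 * s3)"
    by (simp add: algebra_simps)
  then have "2 * (a * b - c * d * real v) * s1
      = c * c * real (g * v) + d * d * real (u * v) - a * a - b * b * real (g * u)"
    unfolding square cross by (simp add: algebra_simps)
  then have "s1 = (c * c * real (g * v) + d * d * real (u * v) - a * a - b * b * real (g * u))
      / (2 * (a * b - c * d * real v))"
    using neq by (simp add: field_simps)
  also have "\<dots> \<in> \<rat>"
    using assms by (intro Rats_divide Rats_diff Rats_add Rats_mult) auto
  finally show False
    using irrational by simp
qed

text \<open>The auxiliary relation is applied to all three roots. If \<open>a\<close> were nonzero,
  the first two relations would give c (a^2 - d^2 s3^2) = 0, and the second factor cannot vanish
  because \<open>s3\<close> is irrational; so \<open>c\<close>, then \<open>b\<close> and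
  \<open>d\<close>, and finally \<open>a\<close> would be 0. Once \<open>a = 0\<close>, the products
  of any two of \<open>b\<close>, \<open>c\<close>, \<open>d\<close> vanish, so at most one term is
  left.\<close>

lemma rational_comb_eq_0:
  assumes rat: "a \<in> \<rat>" "b \<in> \<rat>" "c \<in> \<rat>" "d \<in> \<rat>" and eq: "comb a b c d = 0"
  shows "a = 0 \<and> b = 0 \<and> c = 0 \<and> d = 0"
proof -
  interpret s: biquadratic g v u s2 s1 s3 by (rule swap12)
  interpret r: biquadratic u v g s3 s1 s2 by (rule rotate)
  have e1: "a * b = c * d * real v"
    by (rule rational_comb_eq_0_aux) fact+
  have e2: "a * c = b * d * real u"
    by (rule s.rational_comb_eq_0_aux) (use rat eq in \<open>simp_all add: s.comb_def comb_def algebra_simps\<close>)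
  have e3: "a * d = b * c * real g"
    by (rule r.rational_comb_eq_0_aux) (use rat eq in \<open>simp_all add: r.comb_def comb_def algebra_simps\<close>)
  have "a = 0"
  proof (rule ccontr)
    assume a: "a \<noteq> 0"
    have "a * a * c = (c * d * real v) * d * real u"
      using e1 e2 by (metis mult.assoc mult.left_commute)
    then have "c * (a * a - d * d * (s3 * s3)) = 0"
      unfolding square by (simp add: algebra_simps)
    moreover have "a * a \<noteq> d * d * (s3 * s3)"
    proof
      assume "a * a = d * d * (s3 * s3)"
      then have sq: "a\<^sup>2 = (d * s3)\<^sup>2"
        by (simp add: power2_eq_square algebra_simps)
      with a have "d \<noteq> 0" by auto
      with sq have "s3 = a / d \<or> s3 = - a / d"
        unfolding power2_eq_iff by (auto simp: field_simps)
      then have "s3 \<in> \<rat>"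
        using rat by auto
      then show False
        using irrational by simp
    qed
    ultimately have "c = 0" by simp
    with e1 a e3 have "b = 0" "d = 0" by auto
    with \<open>c = 0\<close> eq a show False by (simp add: comb_def)
  qed
  moreover from this have "c * d = 0" "b * d = 0" "b * c = 0"
    using e1 e2 e3 pos by auto
  moreover have "s1 \<noteq> 0" "s2 \<noteq> 0" "s3 \<noteq> 0"
    using irrational by auto
  ultimately show ?thesis
    using eq by (auto simp: comb_def)
qed

lemma rational_comb_eq_iff:
  assumes "a \<in> \<rat>" "b \<in> \<rat>" "c \<in> \<rat>" "d \<in> \<rat>" "a' \<in> \<rat>" "b' \<in> \<rat>" "c' \<in> \<rat>" "d' \<in> \<rat>"
  shows "comb a b c d = comb a' b' c' d' \<longleftrightarrow> a = a' \<and> b = b' \<and> c = c' \<and> d = d'"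
proof
  assume "comb a b c d = comb a' b' c' d'"
  then have "comb (a - a') (b - b') (c - c') (d - d') = 0"
    by (simp add: comb_def algebra_simps)
  then have "a - a' = 0 \<and> b - b' = 0 \<and> c - c' = 0 \<and> d - d' = 0"
    by (intro rational_comb_eq_0) (use assms in auto)
  then show "a = a' \<and> b = b' \<and> c = c' \<and> d = d'"
    by simp
qed simp

lemma combs_add:
  assumes "R = \<int> \<or> R = \<rat>" "x \<in> combs R" "y \<in> combs R"
  shows "x + y \<in> combs R"
  using assms by (auto elim!: combsE simp: comb_add intro!: combsI)

lemma combs_mult:
  assumes "R = \<int> \<or> R = \<rat>" "x \<in> combs R" "y \<in> combs R"
  shows "x * y \<in> combs R"
  using assms by (auto elim!: combsE simp: comb_mult intro!: combsI)

lemma combs_base: "R = \<int> \<or> R = \<rat> \<Longrightarrow> x \<in> R \<Longrightarrow> x \<in> combs R"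
  using combsI[of x R 0 0 0] by (auto simp: comb_def)

lemma combs_sum:
  assumes "R = \<int> \<or> R = \<rat>" "\<And>i. i \<in> I \<Longrightarrow> f i \<in> combs R"
  shows "sum f I \<in> combs R"
  using assms(2)
  by (induction I rule: infinite_finite_induct)
     (use assms(1) in \<open>auto intro: combs_add combs_base\<close>)

lemma combs_power: "R = \<int> \<or> R = \<rat> \<Longrightarrow> x \<in> combs R \<Longrightarrow> x ^ n \<in> combs R"
  by (induction n) (auto intro: combs_base combs_mult)

text \<open>The automorphism fixing \<open>s1\<close> and negating \<open>s2\<close> and \<open>s3\<close>; its values outside
  \<open>combs \<rat>\<close> are meaningless.\<close>

definition conj :: "real \<Rightarrow> real" where
  "conj x = (THE y. \<exists>a\<in>\<rat>. \<exists>b\<in>\<rat>. \<exists>c\<in>\<rat>. \<exists>d\<in>\<rat>. x = comb a b c d \<and> y = comb a b (- c) (- d))"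

lemma conj_comb:
  assumes "a \<in> \<rat>" "b \<in> \<rat>" "c \<in> \<rat>" "d \<in> \<rat>"
  shows "conj (comb a b c d) = comb a b (- c) (- d)"
  unfolding conj_def
proof (rule the_equality)
  fix y
  assume "\<exists>a'\<in>\<rat>. \<exists>b'\<in>\<rat>. \<exists>c'\<in>\<rat>. \<exists>d'\<in>\<rat>. comb a b c d = comb a' b' c' d' \<and> y = comb a' b' (- c') (- d')"
  then show "y = comb a b (- c) (- d)"
    using assms by (auto simp: rational_comb_eq_iff)
qed (use assms in blast)

lemma conj_mult:
  assumes "x \<in> combs \<rat>" "y \<in> combs \<rat>"
  shows "conj (x * y) = conj x * conj y"
proof -
  obtain a b c d where x: "x = comb a b c d" "a \<in> \<rat>" "b \<in> \<rat>" "c \<in> \<rat>" "d \<in> \<rat>"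
    using assms(1) by (rule combsE)
  obtain a' b' c' d' where y: "y = comb a' b' c' d'" "a' \<in> \<rat>" "b' \<in> \<rat>" "c' \<in> \<rat>" "d' \<in> \<rat>"
    using assms(2) by (rule combsE)
  have "conj (x * y) = comb a b (- c) (- d) * comb a' b' (- c') (- d')"
    unfolding x(1) y(1) comb_mult
    by (subst conj_comb) (use x y in \<open>auto simp: algebra_simps\<close>)
  also have "comb a b (- c) (- d) = conj x"
    unfolding x(1) by (rule conj_comb[symmetric]) fact+
  also have "comb a' b' (- c') (- d') = conj y"
    unfolding y(1) by (rule conj_comb[symmetric]) fact+
  finally show ?thesis .
qed

lemma conj_rational: "a \<in> \<rat> \<Longrightarrow> conj a = a"
  using conj_comb[of a 0 0 0] by (simp add: comb_def)

lemma conj_combs: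
  assumes "R = \<int> \<or> R = \<rat>" "x \<in> combs R"
  shows "conj x \<in> combs R"
proof -
  obtain a b c d where x: "x = comb a b c d" "a \<in> R" "b \<in> R" "c \<in> R" "d \<in> R"
    using assms(2) by (rule combsE)
  moreover have "a \<in> \<rat>" "b \<in> \<rat>" "c \<in> \<rat>" "d \<in> \<rat>"
    using x assms(1) Ints_subset_Rats by blast+
  ultimately show ?thesis
    using assms(1) by (auto simp: conj_comb intro!: combsI)
qed

lemma conj_power: "x \<in> combs \<rat> \<Longrightarrow> conj (x ^ n) = conj x ^ n"
  by (induction n) (simp_all add: conj_rational conj_mult combs_power)

lemma add_conj: "a \<in> \<rat> \<Longrightarrow> b \<in> \<rat> \<Longrightarrow> c \<in> \<rat> \<Longrightarrow> d \<in> \<rat> \<Longrightarrow>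
    comb a b c d + conj (comb a b c d) = comb (2 * a) (2 * b) 0 0"
  unfolding conj_comb by (simp add: comb_def)

text \<open>The inverse comes from a norm in two steps: x times \<open>conj x\<close> is e + f s1,
  and multiplying by e - f s1 gives a rational number, nonzero by independence.\<close>

lemma combs_inverse:
  assumes "x \<in> combs \<rat>"
  shows "inverse x \<in> combs \<rat>"
proof (cases "x = 0")
  case False
  obtain a b c d where x: "x = comb a b c d" "a \<in> \<rat>" "b \<in> \<rat>" "c \<in> \<rat>" "d \<in> \<rat>"
    using assms by (rule combsE)
  define e where "e = a * a + b * b * real (g * u) - c * c * real (g * v) - d * d * real (u * v)"
  define f where "f = 2 * (a * b - c * d * real v)"
  have ef: "e \<in> \<rat>" "f \<in> \<rat>"
    unfolding e_def f_def using x by auto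
  have norm: "x * conj x = comb e f 0 0"
    using x by (simp add: conj_comb comb_mult e_def f_def algebra_simps)
  have norm': "comb e f 0 0 * comb e (- f) 0 0 = e * e - f * f * real (g * u)"
    by (simp add: comb_mult) (simp add: comb_def)
  have "conj x \<noteq> 0"
  proof
    assume "conj x = 0"
    then have "a = 0 \<and> b = 0 \<and> - c = 0 \<and> - d = 0"
      using x by (intro rational_comb_eq_0) (simp_all add: conj_comb)
    with x False show False
      by (simp add: comb_def)
  qed
  with norm False have ef0: "comb e f 0 0 \<noteq> 0"
    by (metis mult_eq_0_iff)
  then have "e \<noteq> 0 \<or> f \<noteq> 0"
    by (auto simp: comb_def)
  then have "comb e (- f) 0 0 \<noteq> 0"
    using rational_comb_eq_0[of e "- f" 0 0] ef by auto
  with ef0 norm' have n0: "e * e - f * f * real (g * u) \<noteq> 0"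
    by (metis mult_eq_0_iff)
  have "x * (conj x * comb e (- f) 0 0 * inverse (e * e - f * f * real (g * u))) = 1"
    using norm norm' n0 by (simp add: mult.assoc[symmetric])
  then have "inverse x = conj x * comb e (- f) 0 0 * inverse (e * e - f * f * real (g * u))"
    by (rule inverse_unique)
  also have "\<dots> \<in> combs \<rat>"
    using ef by (intro combs_mult conj_combs assms combsI combs_base) auto
  finally show ?thesis .
qed (simp add: combs_base)

end

section \<open>Integrality through bounded denominators of powers\<close>

text \<open>If \<open>b\<close> is the reduced denominator of \<open>x\<close>, then every power of
  \<open>b\<close> divides \<open>N\<close>. The exponent \<open>N\<close> already suffices, as 2^N
  exceeds \<open>N\<close>.\<close>

lemma bounded_denominator_powers_imp_Ints:
  fixes x :: real
  assumes "x \<in> \<rat>" and "N > 0" and int: "\<And>k. real N * x ^ k \<in> \<int>"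
  shows "x \<in> \<int>"
proof -
  obtain a b :: int where ab: "b > 0" "coprime a b" "x = of_int a / of_int b"
    using assms(1) by (elim Rats_cases') blast
  have "b ^ k dvd int N" for k
  proof -
    obtain n where "real N * x ^ k = of_int n"
      using int[of k] by (elim Ints_cases)
    then have "real_of_int (int N * a ^ k) = real_of_int (n * b ^ k)"
      using ab by (simp add: power_divide field_simps)
    then have "int N * a ^ k = n * b ^ k"
      by (simp only: of_int_eq_iff)
    then have "b ^ k dvd int N * a ^ k"
      by simp
    then show ?thesis
      using ab by (simp add: coprime_dvd_mult_left_iff coprime_commute)
  qed
  then have le: "b ^ N \<le> int N"
    using assms(2) by (intro zdvd_imp_le) auto
  have "b = 1"
  proof (rule ccontr)
    assume "b \<noteq> 1"
    with ab have "(2::int) ^ N \<le> b ^ N"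
      by (intro power_mono) auto
    moreover have "int N < 2 ^ N"
      using less_exp[of N] by (metis of_nat_less_iff of_nat_numeral of_nat_power)
    ultimately show False
      using le by simp
  qed
  with ab show ?thesis
    by simp
qed

lemma Rats_common_denominator:
  assumes "(a::real) \<in> \<rat>"
  obtains n :: nat where "n > 0" "real n * a \<in> \<int>"
proof -
  obtain i j :: int where "j > 0" "a = of_int i / of_int j"
    using assms by (elim Rats_cases') blast
  then have "real (nat j) * a = of_int i" "nat j > 0"
    by auto
  then show ?thesis
    using that by (metis Ints_of_int)
qed

context biquadratic
begin

lemma combs_denominator:
  assumes "x \<in> combs \<rat>"
  obtains n :: nat where "n > 0" "real n * x \<in> combs \<int>"
proof -
  obtain a b c d where x: "x = comb a b c d" "a \<in> \<rat>" "b \<in> \<rat>" "c \<in> \<rat>" "d \<in> \<rat>"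
    using assms by (rule combsE)
  obtain i j k l :: nat where
    i: "i > 0" "real i * a \<in> \<int>" and j: "j > 0" "real j * b \<in> \<int>" and
    k: "k > 0" "real k * c \<in> \<int>" and l: "l > 0" "real l * d \<in> \<int>"
    using x(2-5) by (metis Rats_common_denominator)
  have "real (i * j * k * l) * x = comb (real (j * k * l) * (real i * a)) (real (i * k * l) * (real j * b))
      (real (i * j * l) * (real k * c)) (real (i * j * k) * (real l * d))"
    unfolding x(1) by (simp add: comb_def algebra_simps)
  also have "\<dots> \<in> combs \<int>"
    by (intro combsI Ints_mult i j k l Ints_of_nat)
  finally show ?thesis
    using that[of "i * j * k * l"] i j k l by simp
qed

text \<open>A common denominator for all powers is preserved by sums, products and conjugation, which
  avoids constructing monic polynomials for sums and products of algebraic integers.\<close>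

definition almost_integral :: "real \<Rightarrow> bool" where
  "almost_integral x \<longleftrightarrow> x \<in> combs \<rat> \<and> (\<exists>N::nat. N > 0 \<and> (\<forall>k. real N * x ^ k \<in> combs \<int>))"

lemma almost_integralE:
  assumes "almost_integral x"
  obtains N :: nat where "x \<in> combs \<rat>" "N > 0" "\<And>k. real N * x ^ k \<in> combs \<int>"
  using assms by (auto simp: almost_integral_def)

lemma almost_integralI:
  "x \<in> combs \<rat> \<Longrightarrow> N > 0 \<Longrightarrow> (\<And>k. real N * x ^ k \<in> combs \<int>) \<Longrightarrow> almost_integral x"
  by (auto simp: almost_integral_def)

lemma combs_powers_denominator:
  assumes "x \<in> combs \<rat>"
  shows "\<exists>N::nat. N > 0 \<and> (\<forall>k<n. real N * x ^ k \<in> combs \<int>)"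
proof (induction n)
  case (Suc n)
  then obtain N :: nat where N: "N > 0" "\<forall>k<n. real N * x ^ k \<in> combs \<int>"
    by blast
  obtain M :: nat where M: "M > 0" "real M * x ^ n \<in> combs \<int>"
    using combs_denominator[OF combs_power[OF _ assms, of n]] by auto
  have "real (M * N) * x ^ k \<in> combs \<int>" if "k < Suc n" for k
  proof (cases "k = n")
    case True
    have "real N * (real M * x ^ n) \<in> combs \<int>"
      by (intro combs_mult M combs_base) auto
    with True show ?thesis
      by (simp add: mult_ac)
  next
    case False
    with that N have "real N * x ^ k \<in> combs \<int>"
      by simp
    then have "real M * (real N * x ^ k) \<in> combs \<int>"
      by (metis Ints_of_nat combs_base combs_mult)
    then show ?thesis
      by (simp add: mult_ac)
  qed
  with M N show ?case
    by (intro exI[of _ "M * N"]) auto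
qed (auto intro: exI[of _ 1])

text \<open>The monic equation writes each power from the degree on as an integer combination of
  lower ones, so a common denominator of the finitely many initial powers serves for all of
  them.\<close>

lemma algebraic_int_imp_almost_integral:
  assumes "algebraic_int x" and "x \<in> combs \<rat>"
  shows "almost_integral x"
proof -
  obtain P where P: "lead_coeff P = 1" "\<And>i. coeff P i \<in> \<int>" "poly P x = 0"
    using assms(1) by (auto elim: algebraic_int.cases)
  define n where "n = degree P"
  have root: "x ^ n = (\<Sum>i<n. - coeff P i * x ^ i)"
  proof -
    have "0 = (\<Sum>i\<le>n. coeff P i * x ^ i)"
      using P(3) by (simp add: poly_altdef n_def)
    also have "\<dots> = (\<Sum>i<n. coeff P i * x ^ i) + x ^ n"
      using P(1) by (simp add: lessThan_Suc_atMost[symmetric] n_def)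
    finally show ?thesis
      by (simp add: sum_negf)
  qed
  obtain N :: nat where N: "N > 0" "\<forall>k<n. real N * x ^ k \<in> combs \<int>"
    using combs_powers_denominator[OF assms(2)] by blast
  have "real N * x ^ k \<in> combs \<int>" for k
  proof (induction k rule: less_induct)
    case (less k)
    show ?case
    proof (cases "k < n")
      case False
      then have "x ^ k = x ^ (k - n) * x ^ n"
        by (simp add: power_add[symmetric])
      then have "real N * x ^ k = (\<Sum>i<n. - coeff P i * (real N * x ^ (k - n + i)))"
        unfolding root by (simp add: sum_distrib_left power_add mult_ac)
      also have "\<dots> \<in> combs \<int>"
        using False P(2) by (intro combs_sum combs_mult combs_base less) auto
      finally show ?thesis .
    qed (use N in blast)
  qed
  with N assms(2) show ?thesis
    by (intro almost_integralI)
qed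

lemma almost_integral_conj:
  assumes "almost_integral x"
  shows "almost_integral (conj x)"
proof -
  obtain N :: nat where N: "x \<in> combs \<rat>" "N > 0" "\<And>k. real N * x ^ k \<in> combs \<int>"
    using assms by (rule almost_integralE) blast
  have "real N * conj x ^ k = conj (real N * x ^ k)" for k
    using N(1) by (simp add: conj_mult conj_power conj_rational combs_base combs_power)
  with N show ?thesis
    by (intro almost_integralI[of _ N] conj_combs) (auto intro: conj_combs)
qed

lemma almost_integral_add:
  assumes "almost_integral x" "almost_integral y"
  shows "almost_integral (x + y)"
proof -
  obtain N :: nat where N: "x \<in> combs \<rat>" "N > 0" "\<And>k. real N * x ^ k \<in> combs \<int>"
    using assms(1) by (rule almost_integralE) blast
  obtain M :: nat where M: "y \<in> combs \<rat>" "M > 0" "\<And>k. real M * y ^ k \<in> combs \<int>"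
    using assms(2) by (rule almost_integralE) blast
  have "real (N * M) * (x + y) ^ k \<in> combs \<int>" for k
  proof -
    have "real (N * M) * (x + y) ^ k =
        (\<Sum>i\<le>k. of_nat (k choose i) * ((real N * x ^ i) * (real M * y ^ (k - i))))"
      unfolding binomial_ring by (simp add: sum_distrib_left mult_ac)
    also have "\<dots> \<in> combs \<int>"
      by (intro combs_sum combs_mult combs_base N M) auto
    finally show ?thesis .
  qed
  with N M show ?thesis
    by (intro almost_integralI[of _ "N * M"] combs_add) auto
qed

lemma almost_integral_mult:
  assumes "almost_integral x" "almost_integral y"
  shows "almost_integral (x * y)"
proof -
  obtain N :: nat where N: "x \<in> combs \<rat>" "N > 0" "\<And>k. real N * x ^ k \<in> combs \<int>"
    using assms(1) by (rule almost_integralE) blast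
  obtain M :: nat where M: "y \<in> combs \<rat>" "M > 0" "\<And>k. real M * y ^ k \<in> combs \<int>"
    using assms(2) by (rule almost_integralE) blast
  have "real (N * M) * (x * y) ^ k = (real N * x ^ k) * (real M * y ^ k)" for k
    by (simp add: power_mult_distrib mult_ac)
  then have "real (N * M) * (x * y) ^ k \<in> combs \<int>" for k
    using combs_mult[OF _ N(3) M(3), of k k] by metis
  moreover have "x * y \<in> combs \<rat>"
    by (intro combs_mult N M) simp
  ultimately show ?thesis
    using N M by (intro almost_integralI[of _ "N * M"]) auto
qed

text \<open>By uniqueness of rational coordinates, a rational element of \<open>combs \<int>\<close>
  is an integer; this reduces the claim to bounded denominators of powers of a rational
  number.\<close>

lemma rational_almost_integral_imp_Ints:
  assumes "almost_integral x" and "x \<in> \<rat>"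
  shows "x \<in> \<int>"
proof -
  obtain N :: nat where N: "N > 0" "\<And>k. real N * x ^ k \<in> combs \<int>"
    using assms(1) by (rule almost_integralE) blast
  have "real N * x ^ k \<in> \<int>" for k
  proof -
    obtain a b c d where e: "real N * x ^ k = comb a b c d" "a \<in> \<int>" "b \<in> \<int>" "c \<in> \<int>" "d \<in> \<int>"
      using N(2)[of k] by (rule combsE)
    have "comb (real N * x ^ k) 0 0 0 = comb a b c d"
      using e(1) by (simp add: comb_def)
    moreover have "real N * x ^ k \<in> \<rat>"
      using assms(2) by simp
    ultimately have "real N * x ^ k = a"
      using e(2-5) Ints_subset_Rats by (subst (asm) rational_comb_eq_iff) auto
    with e(2) show ?thesis
      by simp
  qed
  then show ?thesis
    by (rule bounded_denominator_powers_imp_Ints[OF assms(2) N(1)])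
qed

text \<open>The trace to the quadratic subfield generated by \<open>s1\<close> is almost integral, so its own trace
  and norm are integers.\<close>

lemma almost_integral_coefficients_s1:
  assumes ai: "almost_integral (comb a b c d)"
    and rat: "a \<in> \<rat>" "b \<in> \<rat>" "c \<in> \<rat>" "d \<in> \<rat>"
    and sqf: "squarefree (g * u)"
  shows "\<exists>i j :: int. 4 * a = of_int i \<and> 4 * b = of_int j \<and> 4 dvd i\<^sup>2 - int (g * u) * j\<^sup>2"
proof -
  \<comment> \<open>\<open>conj\<close> fixes \<open>s1\<close>; the conjugation of the swapped copy
    fixes \<open>s2\<close> and negates \<open>s1\<close>, so on the subfield generated by
    \<open>s1\<close> it is the nontrivial automorphism.\<close>
  interpret s: biquadratic g v u s2 s1 s3 by (rule swap12)
  have "s.comb a b c d = comb a c b d" for a b c d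
    by (simp add: s.comb_def comb_def)
  then have combs_eq: "s.combs R = combs R" for R
    unfolding s.combs_def combs_def by auto
  have ai_eq: "s.almost_integral x = almost_integral x" for x
    unfolding s.almost_integral_def almost_integral_def combs_eq ..
  define e where "e = comb (2 * a) (2 * b) 0 0"
  have e: "almost_integral e"
    unfolding e_def using add_conj[OF rat] almost_integral_add[OF ai almost_integral_conj[OF ai]] by simp
  have se: "e = s.comb (2 * a) 0 (2 * b) 0"
    by (simp add: e_def comb_def s.comb_def)
  have conj_e: "s.conj e = comb (2 * a) (- 2 * b) 0 0"
    unfolding se using rat by (subst s.conj_comb) (auto simp: s.comb_def comb_def)
  have conj_ai: "almost_integral (s.conj e)"
    using e s.almost_integral_conj ai_eq by simp
  have "e + s.conj e = 4 * a"
    unfolding conj_e by (simp add: e_def comb_def)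
  then have "4 * a \<in> \<int>"
    using rational_almost_integral_imp_Ints[OF almost_integral_add[OF e conj_ai]] rat by simp
  then obtain i where i: "4 * a = of_int i"
    by (elim Ints_cases)
  have norm: "e * s.conj e = (2 * a)\<^sup>2 - real (g * u) * (2 * b)\<^sup>2"
    unfolding conj_e unfolding e_def comb_mult by (simp add: comb_def power2_eq_square)
  then have "(2 * a)\<^sup>2 - real (g * u) * (2 * b)\<^sup>2 \<in> \<int>"
    using rational_almost_integral_imp_Ints[OF almost_integral_mult[OF e conj_ai]] rat by simp
  then obtain n where n: "(2 * a)\<^sup>2 - real (g * u) * (2 * b)\<^sup>2 = of_int n"
    by (elim Ints_cases)
  \<comment> \<open>Scaling the norm by 4 serves twice: it gives the integrality of
    \<open>4 * b\<close> through squarefreeness, and it is itself the divisibility by 4 in the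
    conclusion.\<close>
  have n': "(4 * a)\<^sup>2 - (4 * b)\<^sup>2 * real (g * u) = of_int (4 * n)"
    unfolding of_int_mult n[symmetric] by (simp add: power2_eq_square algebra_simps)
  have "(4 * b)\<^sup>2 * real (g * u) = of_int (i\<^sup>2 - 4 * n)"
    using n' unfolding i by simp
  then have "(4 * b)\<^sup>2 * real (g * u) \<in> \<int>"
    by simp
  then have "4 * b \<in> \<int>"
    using squarefree_mult_square_integer[of "g * u" "4 * b"] sqf pos rat by simp
  then obtain j where j: "4 * b = of_int j"
    by (elim Ints_cases)
  have "real_of_int (i\<^sup>2 - int (g * u) * j\<^sup>2) = of_int (4 * n)"
    unfolding n'[symmetric] i j by (simp add: mult_ac)
  then have "i\<^sup>2 - int (g * u) * j\<^sup>2 = 4 * n"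
    by (simp only: of_int_eq_iff)
  then show ?thesis
    using i j by (metis dvd_triv_left)
qed

text \<open>The coefficients at \<open>s1\<close> and \<open>s3\<close> are linked through the
  rational coefficient: modulo 2 both numerators agree with \<open>4 * a\<close>, because
  \<open>g * u\<close> and \<open>u * v\<close> are odd.\<close>

lemma almost_integral_coefficients_parity:
  assumes ai: "almost_integral (comb a b c d)"
    and rat: "a \<in> \<rat>" "b \<in> \<rat>" "c \<in> \<rat>" "d \<in> \<rat>"
    and sqf: "squarefree (g * u)" "squarefree (u * v)"
    and odd: "odd (g * u)" "odd (u * v)"
  shows "\<exists>j l :: int. 4 * b = of_int j \<and> 4 * d = of_int l \<and> (even j \<longleftrightarrow> even l)"
proof -
  interpret r: biquadratic u v g s3 s1 s2 by (rule rotate)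
  have "r.comb a b c d = comb a c d b" for a b c d
    by (simp add: r.comb_def comb_def)
  then have "r.combs R = combs R" for R
    unfolding r.combs_def combs_def by auto
  then have ai_eq: "r.almost_integral x = almost_integral x" for x
    unfolding r.almost_integral_def almost_integral_def by simp
  have comb_eq: "comb a b c d = r.comb a d b c"
    by (simp add: comb_def r.comb_def)
  have parity: "even y \<longleftrightarrow> even x" if "4 dvd x\<^sup>2 - int n * y\<^sup>2" "odd n" for x y :: int and n
  proof -
    have "even (x\<^sup>2 - int n * y\<^sup>2)"
      using dvd_trans[OF _ that(1), of 2] by simp
    with that(2) show ?thesis
      by auto
  qed
  obtain i j where ij: "4 * a = of_int i" "4 * b = of_int j" "4 dvd i\<^sup>2 - int (g * u) * j\<^sup>2"
    using almost_integral_coefficients_s1[OF ai rat sqf(1)] by blast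
  obtain i' l where il: "4 * a = of_int i'" "4 * d = of_int l" "4 dvd i'\<^sup>2 - int (u * v) * l\<^sup>2"
    using r.almost_integral_coefficients_s1[of a d b c] ai rat sqf(2) ai_eq comb_eq by auto
  have "i' = i"
    using ij(1) il(1) by simp
  then show ?thesis
    using ij il parity[OF ij(3) odd(1)] parity[OF il(3) odd(2)] by blast
qed

end

section \<open>The generated field, its real embeddings and a totally positive integer\<close>

lemma real_ring_simps [simp]:
  "carrier real_ring = UNIV" "x \<otimes>\<^bsub>real_ring\<^esub> y = x * y" "\<one>\<^bsub>real_ring\<^esub> = 1"
  "\<zero>\<^bsub>real_ring\<^esub> = 0" "x \<oplus>\<^bsub>real_ring\<^esub> y = x + y"
  by (simp_all add: ring_of_type_algebra_def)

lemma a_inv_real_ring: "\<ominus>\<^bsub>real_ring\<^esub> x = - x"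
proof -
  interpret cring real_ring by (rule cring_from_type_algebra)
  show ?thesis
    by (rule minus_equality) simp_all
qed

lemma m_inv_real_ring: "x \<noteq> 0 \<Longrightarrow> inv\<^bsub>real_ring\<^esub> x = inverse x"
proof -
  assume "x \<noteq> 0"
  interpret cring real_ring by (rule cring_from_type_algebra)
  show ?thesis
    by (rule comm_inv_char) (use \<open>x \<noteq> 0\<close> in simp_all)
qed

lemma
  shows one_in_generate_field_real: "1 \<in> generate_field real_ring H"
    and add_in_generate_field_real:
      "\<And>x y. x \<in> generate_field real_ring H \<Longrightarrow> y \<in> generate_field real_ring H \<Longrightarrow> x + y \<in> generate_field real_ring H"
    and mult_in_generate_field_real:
      "\<And>x y. x \<in> generate_field real_ring H \<Longrightarrow> y \<in> generate_field real_ring H \<Longrightarrow> x * y \<in> generate_field real_ring H"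
    and inverse_in_generate_field_real:
      "\<And>x. x \<in> generate_field real_ring H \<Longrightarrow> x \<noteq> 0 \<Longrightarrow> inverse x \<in> generate_field real_ring H"
  using generate_field.one[of real_ring H] generate_field.eng_add[of _ real_ring H]
    generate_field.eng_mult[of _ real_ring H] generate_field.m_inv[of _ real_ring H]
  by (auto simp: m_inv_real_ring)

lemma of_nat_in_generate_field_real: "n > 0 \<Longrightarrow> real n \<in> generate_field real_ring H"
proof (induction n rule: nat_induct_non_zero)
  case (Suc n)
  then show ?case
    unfolding of_nat_Suc by (intro add_in_generate_field_real one_in_generate_field_real)
qed (simp add: one_in_generate_field_real)

lemma real_embeddingD:
  assumes "\<sigma> \<in> real_embeddings K"
  shows "x \<in> K \<Longrightarrow> y \<in> K \<Longrightarrow> \<sigma> (x + y) = \<sigma> x + \<sigma> y"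
    and "x \<in> K \<Longrightarrow> y \<in> K \<Longrightarrow> \<sigma> (x * y) = \<sigma> x * \<sigma> y"
    and "\<sigma> 1 = 1"
  using assms by (simp_all add: real_embeddings_def ring_hom_def)

lemma real_embedding_of_nat:
  assumes "\<sigma> \<in> real_embeddings (generate_field real_ring H)" and "n > 0"
  shows "\<sigma> (real n) = real n"
  using assms(2)
proof (induction n rule: nat_induct_non_zero)
  case (Suc n)
  then show ?case
    unfolding of_nat_Suc
    by (simp add: real_embeddingD[OF assms(1)] one_in_generate_field_real of_nat_in_generate_field_real)
qed (simp add: real_embeddingD[OF assms(1)])

lemma (in biquadratic) generate_field_subset_combs:
  "generate_field real_ring {s1, s2} \<subseteq> combs \<rat>"
proof
  fix x assume "x \<in> generate_field real_ring {s1, s2}"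
  then show "x \<in> combs \<rat>"
  proof (induction rule: generate_field.induct)
    case (incl h)
    have "comb 0 1 0 0 \<in> combs \<rat>" "comb 0 0 1 0 \<in> combs \<rat>"
      by (auto intro!: combsI)
    with incl show ?case
      by (auto simp: comb_def)
  next
    case (a_inv h)
    have "- 1 * h \<in> combs \<rat>"
      by (rule combs_mult[OF _ combs_base]) (use a_inv in auto)
    then show ?case
      by (simp add: a_inv_real_ring)
  next
    case (m_inv h)
    then show ?case
      by (simp add: m_inv_real_ring combs_inverse)
  qed (simp_all add: combs_add combs_mult combs_base)
qed

text \<open>The element is a root of X^2 - c X + n with n = (c^2 - \<kappa>^2 p)/4, an integer since
  \<open>c\<close> and \<open>\<kappa>\<close> have equal parity and p = 1 (mod 4). Every embedding
  maps sqrt p to a square root of \<open>p\<close>, so twice each image is at least c - \<kappa>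
  sqrt p > 0.\<close>

lemma totally_positive_integer_half:
  fixes p \<kappa> c :: nat and z :: int
  assumes "p mod 4 = 1" and c: "int c = int \<kappa> + 2 * z" and pos: "real c > real \<kappa> * sqrt (real p)"
    and \<kappa>: "\<kappa> > 0"
  shows "(real c + real \<kappa> * sqrt (real p)) / 2 \<in> totally_positive_integers (biquadratic_field p q)"
proof -
  define K where "K = generate_field real_ring {sqrt (real p), sqrt (real q)}"
  define \<alpha> where "\<alpha> = (real c + real \<kappa> * sqrt (real p)) / 2"
  have p0: "p > 0"
    using assms(1) by (cases p) auto
  have c0: "c > 0"
    using pos \<kappa> p0 by (cases c) (auto simp: mult_less_0_iff)
  have nat: "real n \<in> K" if "n > 0" for n
    using that unfolding K_def by (rule of_nat_in_generate_field_real)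
  have s: "sqrt (real p) \<in> K"
    unfolding K_def by (intro generate_field.incl) simp
  have ks: "real \<kappa> * sqrt (real p) \<in> K"
    using nat[OF \<kappa>] s unfolding K_def by (rule mult_in_generate_field_real)
  have cks: "real c + real \<kappa> * sqrt (real p) \<in> K"
    using nat[OF c0] ks unfolding K_def by (rule add_in_generate_field_real)
  have "inverse 2 \<in> K"
    using nat[of 2] unfolding K_def by (intro inverse_in_generate_field_real) auto
  then have \<alpha>: "\<alpha> \<in> K"
    using cks unfolding K_def \<alpha>_def divide_inverse by (rule mult_in_generate_field_real[rotated])
  have "algebraic_int \<alpha>"
  proof -
    define h where "h = p div 4"
    have p: "real p = 4 * real h + 1"
      using assms(1) mult_div_mod_eq[of 4 p] unfolding h_def by linarith
    have c': "real c = real \<kappa> + 2 * of_int z"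
      using c by linarith
    define n where "n = z\<^sup>2 + z * int \<kappa> - (int \<kappa>)\<^sup>2 * int h"
    have "\<alpha> * \<alpha> = (real c)\<^sup>2 / 4 + (real \<kappa>)\<^sup>2 * (sqrt (real p) * sqrt (real p)) / 4
        + real c * (real \<kappa> * sqrt (real p)) / 2"
      by (simp add: \<alpha>_def power2_eq_square field_simps)
    also have "sqrt (real p) * sqrt (real p) = 4 * real h + 1"
      using p by simp
    finally have "of_int n - real c * \<alpha> + \<alpha> * \<alpha> = 0"
      unfolding c' n_def \<alpha>_def by (simp add: power2_eq_square field_simps)
    then have "poly [:of_int n, - real c, 1:] \<alpha> = 0"
      by (simp add: algebra_simps)
    moreover have "coeff [:of_int n, - real c, 1:] i \<in> \<int>" for i
      by (auto simp: coeff_pCons split: nat.splits)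
    ultimately show ?thesis
      by (intro algebraic_int.intros[of "[:of_int n, - real c, 1:]"]) auto
  qed
  moreover have "\<sigma> \<alpha> > 0" if \<sigma>: "\<sigma> \<in> real_embeddings K" for \<sigma>
  proof -
    have add: "\<sigma> (x + y) = \<sigma> x + \<sigma> y" and mult: "\<sigma> (x * y) = \<sigma> x * \<sigma> y"
      if "x \<in> K" "y \<in> K" for x y
      using that real_embeddingD[OF \<sigma>] by auto
    have \<sigma>_nat: "\<sigma> (real n) = real n" if "n > 0" for n
      using \<sigma> that unfolding K_def by (rule real_embedding_of_nat)
    have "\<sigma> (sqrt (real p)) * \<sigma> (sqrt (real p)) = \<sigma> (real p)"
      using mult[OF s s] by simp
    then have "(\<sigma> (sqrt (real p)))\<^sup>2 = real p"
      using \<sigma>_nat[OF p0] by (simp add: power2_eq_square)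
    then have "\<bar>\<sigma> (sqrt (real p))\<bar> = sqrt (real p)"
      by (metis real_sqrt_abs)
    then have "real \<kappa> * \<sigma> (sqrt (real p)) \<ge> real \<kappa> * - sqrt (real p)"
      by (intro mult_left_mono) auto
    \<comment> \<open>Doubling avoids evaluating the embedding at 1/2.\<close>
    moreover have "\<sigma> \<alpha> + \<sigma> \<alpha> = real c + real \<kappa> * \<sigma> (sqrt (real p))"
    proof -
      have "\<sigma> \<alpha> + \<sigma> \<alpha> = \<sigma> (\<alpha> + \<alpha>)"
        using add[OF \<alpha> \<alpha>] by simp
      also have "\<alpha> + \<alpha> = real c + real \<kappa> * sqrt (real p)"
        by (simp add: \<alpha>_def)
      finally show ?thesis
        using add[OF nat[OF c0] ks] mult[OF nat[OF \<kappa>] s] \<sigma>_nat[OF \<kappa>] \<sigma>_nat[OF c0] by simp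
    qed
    ultimately show ?thesis
      using pos by simp
  qed
  ultimately show ?thesis
    using \<alpha> unfolding \<alpha>_def K_def totally_positive_integers_def ring_of_integers_def biquadratic_field_def
    by auto
qed

section \<open>The interval \<open>I4\<close>\<close>

text \<open>After division by \<open>N\<close> the hypothesis places \<open>s\<close> strictly within
  \<open>2 sqrt (m / N)\<close> of \<open>m \<kappa> / N\<close>. This contradicts the lower endpoint of the interval when
  \<open>N \<ge> t\<close> and the upper one when \<open>N < t\<close>.\<close>

lemma I4_not_near_quotient:
  fixes m t \<kappa> N :: nat and s :: real
  assumes s: "s \<in> I4 m t \<kappa>" and pos: "m > 0" "t > 0" "\<kappa> > 0"
    and near: "(s * real N - real m * real \<kappa>)\<^sup>2 < 4 * real m * real N"
  shows False
proof -
  have N0: "N > 0"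
    using near by (cases N) auto
  define w where "w = sqrt (real m)"
  \<comment> \<open>In terms of y = 1 / sqrt N the two bounds become the quadratics m \<kappa> y^2 +
    2 w y and m \<kappa> y^2 - 2 w y, to be compared at different values of
    \<open>y\<close>.\<close>
  define y where "y = 1 / sqrt (real N)"
  have w: "w > 0" "w * w = real m" and y: "y > 0" "y * y * real N = 1"
    using pos N0 by (auto simp: w_def y_def)
  have "\<bar>s * real N - real m * real \<kappa>\<bar> < sqrt (4 * real m * real N)"
    using near by (metis real_sqrt_abs real_sqrt_less_mono)
  also have "sqrt (4 * real m * real N) = 2 * w * sqrt (real N)"
    by (simp add: real_sqrt_mult w_def)
  finally have "\<bar>s * real N - real m * real \<kappa>\<bar> * (y * y) < 2 * w * sqrt (real N) * (y * y)"
    using y by (intro mult_strict_right_mono) auto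
  also have "\<bar>s * real N - real m * real \<kappa>\<bar> * (y * y) = \<bar>(s * real N - real m * real \<kappa>) * (y * y)\<bar>"
    using y by (simp add: abs_mult)
  also have "(s * real N - real m * real \<kappa>) * (y * y) = s * (y * y * real N) - real m * real \<kappa> * (y * y)"
    by (simp add: algebra_simps)
  also have "2 * w * sqrt (real N) * (y * y) = 2 * w * y"
    using N0 by (simp add: y_def real_div_sqrt field_simps)
  finally have sy: "\<bar>s - real m * real \<kappa> * (y * y)\<bar> < 2 * w * y"
    using y(2) by simp
  show False
  proof (cases "t \<le> N")
    case True
    define y0 where "y0 = 1 / sqrt (real t)"
    have "y \<le> y0"
      unfolding y_def y0_def using True pos by (intro divide_left_mono) auto
    then have "y * y \<le> y0 * y0"
      using y by (intro mult_mono) auto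
    then have "real m * real \<kappa> * (y * y) + 2 * w * y \<le> real m * real \<kappa> * (y0 * y0) + 2 * w * y0"
      using w \<open>y \<le> y0\<close> by (intro add_mono mult_left_mono) auto
    also have "\<dots> \<le> s"
      using s pos by (auto simp: I4_def Let_def y0_def w_def split: if_splits)
    finally show False
      using sy by linarith
  next
    case False
    define y1 where "y1 = 1 / sqrt (real t - 1)"
    have t: "t > 1" "real N \<le> real t - 1"
      using False N0 by linarith+
    have "y1 \<le> y" 
      unfolding y_def y1_def using t N0 by (intro divide_left_mono) auto
    have y1: "y1 > 0"
      using t by (simp add: y1_def)
    have "s \<le> real m * real \<kappa> * (y1 * y1) - 2 * w * y1"
      using s t by (auto simp: I4_def Let_def y1_def w_def split: if_splits)
    \<comment> \<open>The quadratic y (m \<kappa> y - 2 w) is not monotone for all positive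
      \<open>y\<close>. Positivity of \<open>s\<close> forces the second factor to be positive at
      \<open>y1\<close>, and from there on the quadratic increases.\<close>
    moreover have "s > 0"
    proof -
      have "0 < real m * real \<kappa> / real t + 2 * (sqrt (real m) / sqrt (real t))"
        using pos by (intro add_pos_pos) auto
      then show ?thesis
        using s t by (auto simp: I4_def Let_def)
    qed
    ultimately have "0 < (real m * real \<kappa> * y1 - 2 * w) * y1"
      by (simp add: algebra_simps)
    then have "real m * real \<kappa> * y1 - 2 * w > 0"
      using y1 by (simp add: zero_less_mult_iff)
    moreover have "real m * real \<kappa> * y1 - 2 * w \<le> real m * real \<kappa> * y - 2 * w"
      using \<open>y1 \<le> y\<close> by (intro diff_right_mono mult_left_mono) auto
    ultimately have "(real m * real \<kappa> * y1 - 2 * w) * y1 \<le> (real m * real \<kappa> * y - 2 * w) * y"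
      using \<open>y1 \<le> y\<close> y1 by (intro mult_mono) auto
    with \<open>s \<le> _\<close> have "s \<le> real m * real \<kappa> * (y * y) - 2 * w * y"
      by (simp add: algebra_simps)
    then show False
      using sy by linarith
  qed
qed

text \<open>With x = sqrt t and y = sqrt (t - 1), so x^2 - y^2 = 1, the endpoints are in order once
  2 x y (x + y) \<le> \<kappa> sqrt m. Squaring this yields the bound, as (x + y)^2 = 2 t - 1 + 2
  sqrt (t (t - 1)); the factor 4 is the square of the 2 in the endpoints.\<close>

lemma I4_nonempty:
  fixes m t \<kappa> :: nat
  assumes pos: "m > 0" "t > 0" "\<kappa> > 0"
    and m: "real m \<ge> 4 * (real t * (real t - 1)
                 * (2 * real t - 1 + 2 * sqrt (real t * (real t - 1)))) / (real \<kappa>)\<^sup>2"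
  shows "I4 m t \<kappa> \<noteq> {}"
proof (cases "t = 1")
  case False
  define w where "w = sqrt (real m)"
  define x where "x = sqrt (real t)"
  define y where "y = sqrt (real t - 1)"
  have t: "real t = x * x" "real t - 1 = y * y" "x * x - y * y = 1" and xy: "x > 0" "y > 0"
    and w: "w > 0" "real m = w * w"
    using False pos by (auto simp: x_def y_def w_def)
  have sq: "sqrt (real t * (real t - 1)) = x * y"
    by (simp add: x_def y_def real_sqrt_mult)
  have "4 * (real t * (real t - 1) * (2 * real t - 1 + 2 * sqrt (real t * (real t - 1))))
      = 4 * (x * x * (y * y) * (2 * (x * x) - (x * x - y * y) + 2 * (x * y)))"
    unfolding sq unfolding t(2) unfolding t(1) by (simp add: t(3))
  also have "\<dots> = (2 * (x * y) * (x + y))\<^sup>2"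
    by (simp add: power2_eq_square algebra_simps)
  finally have "(2 * (x * y) * (x + y))\<^sup>2 \<le> (w * real \<kappa>)\<^sup>2"
    using m pos by (simp add: field_simps w(2) power2_eq_square)
  then have "2 * (x * y) * (x + y) \<le> w * real \<kappa>"
    using w by (intro power2_le_imp_le[of "2 * (x * y) * (x + y)"]) auto
  then have "2 * (x * y) * (x + y) * w \<le> w * real \<kappa> * w"
    using w by (intro mult_right_mono) auto
  then have le: "2 * (x * y) * (x + y) * w \<le> w * w * real \<kappa> * (x * x - y * y)"
    unfolding t(3) by (simp add: mult_ac)
  have "(w * w * real \<kappa> / (y * y) - 2 * (w / y)) - (w * w * real \<kappa> / (x * x) + 2 * (w / x))
      = (w * w * real \<kappa> * (x * x - y * y) - 2 * (x * y) * (x + y) * w) / ((x * x) * (y * y))"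
    using xy by (simp add: field_simps)
  also have "\<dots> \<ge> 0"
    using le xy by simp
  finally have "w * w * real \<kappa> / (x * x) + 2 * (w / x) \<le> w * w * real \<kappa> / (y * y) - 2 * (w / y)"
    by simp
  then show ?thesis
    using False unfolding I4_def Let_def w(2)[symmetric] t(1)[symmetric] t(2)[symmetric]
    by (simp add: x_def y_def w_def)
qed (simp add: I4_def Let_def)

section \<open>Coefficients of a sum of squares and the final contradiction\<close>

lemma biquadratic_sqrt:
  fixes p q r :: nat
  assumes sqf: "squarefree p" "squarefree q" and p: "p > 1"
    and r: "r = p * q div (gcd p q)\<^sup>2" and less: "p < q" "q < r"
  obtains g u v where "p = g * u" "q = g * v" "r = u * v" "squarefree r"
    and "biquadratic g u v (sqrt p) (sqrt q) (sqrt r)"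
proof -
  define g where "g = gcd p q"
  have g0: "g > 0"
    using p by (simp add: g_def)
  obtain u v where "p = u * g" "q = v * g" and uv: "coprime u v"
    using gcd_coprime_exists[of p q] g0 unfolding g_def by auto
  then have pq: "p = g * u" "q = g * v"
    by simp_all
  have "p * q = (u * v) * g\<^sup>2"
    unfolding pq by (simp add: power2_eq_square)
  then have ruv: "r = u * v"
    using r g0 unfolding g_def[symmetric] by simp
  have sqr: "squarefree r"
    unfolding ruv using sqf uv unfolding pq
    by (intro squarefree_mult_coprime) (auto dest: squarefree_multD)
  have uv0: "u > 0" "v > 0"
    using pq p less by (auto intro: Nat.gr0I)
  have "biquadratic g u v (sqrt p) (sqrt q) (sqrt r)"
  proof
    have "sqrt p * sqrt q = sqrt ((real g)\<^sup>2 * r)" "sqrt p * sqrt r = sqrt ((real u)\<^sup>2 * q)"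
      "sqrt q * sqrt r = sqrt ((real v)\<^sup>2 * p)"
      unfolding real_sqrt_mult[symmetric] pq ruv by (simp_all add: power2_eq_square mult_ac)
    then show "sqrt p * sqrt q = real g * sqrt r" "sqrt p * sqrt r = real u * sqrt q"
      "sqrt q * sqrt r = real v * sqrt p"
      by (simp_all only: real_sqrt_mult real_sqrt_abs abs_of_nat)
    show "sqrt p \<notin> \<rat>" "sqrt q \<notin> \<rat>" "sqrt r \<notin> \<rat>"
      using sqrt_squarefree_irrational[OF sqf(1)] sqrt_squarefree_irrational[OF sqf(2)]
        sqrt_squarefree_irrational[OF sqr] p less by simp_all
  qed (use g0 uv0 pq ruv in \<open>simp_all add: real_sqrt_mult[symmetric] del: of_nat_mult\<close>)
  with pq ruv sqr show ?thesis
    using that by blast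
qed

context biquadratic
begin

text \<open>Only the coefficients at 1 and \<open>s1\<close> are compared later; those at
  \<open>s2\<close> and \<open>s3\<close> need only be rational for uniqueness of coordinates to
  apply.\<close>

lemma sum_list_squares_comb:
  assumes "\<And>x. x \<in> set xs \<Longrightarrow> x = comb (a x) (b x) (c x) (d x)"
    and "\<And>x. x \<in> set xs \<Longrightarrow> a x \<in> \<rat> \<and> b x \<in> \<rat> \<and> c x \<in> \<rat> \<and> d x \<in> \<rat>"
  shows "\<exists>C\<in>\<rat>. \<exists>D\<in>\<rat>. (\<Sum>x\<leftarrow>xs. x\<^sup>2) =
    comb (\<Sum>x\<leftarrow>xs. (a x)\<^sup>2 + (b x)\<^sup>2 * real (g * u) + (c x)\<^sup>2 * real (g * v) + (d x)\<^sup>2 * real (u * v))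
         (\<Sum>x\<leftarrow>xs. 2 * (a x * b x + c x * d x * real v)) C D"
  using assms
proof (induction xs)
  case Nil
  show ?case
    by (intro bexI[of _ 0]) (auto simp: comb_def)
next
  case (Cons y xs)
  have "\<exists>C\<in>\<rat>. \<exists>D\<in>\<rat>. (\<Sum>x\<leftarrow>xs. x\<^sup>2) =
    comb (\<Sum>x\<leftarrow>xs. (a x)\<^sup>2 + (b x)\<^sup>2 * real (g * u) + (c x)\<^sup>2 * real (g * v) + (d x)\<^sup>2 * real (u * v))
         (\<Sum>x\<leftarrow>xs. 2 * (a x * b x + c x * d x * real v)) C D"
    by (rule Cons.IH; rule Cons.prems; simp)
  then obtain C D where CD: "C \<in> \<rat>" "D \<in> \<rat>" and IH: "(\<Sum>x\<leftarrow>xs. x\<^sup>2) =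
    comb (\<Sum>x\<leftarrow>xs. (a x)\<^sup>2 + (b x)\<^sup>2 * real (g * u) + (c x)\<^sup>2 * real (g * v) + (d x)\<^sup>2 * real (u * v))
         (\<Sum>x\<leftarrow>xs. 2 * (a x * b x + c x * d x * real v)) C D"
    by blast
  have "y = comb (a y) (b y) (c y) (d y)"
    by (rule Cons.prems) simp
  then have "y\<^sup>2 = comb (a y) (b y) (c y) (d y) * comb (a y) (b y) (c y) (d y)"
    by (metis power2_eq_square)
  also have "\<dots> = comb ((a y)\<^sup>2 + (b y)\<^sup>2 * real (g * u) + (c y)\<^sup>2 * real (g * v) + (d y)\<^sup>2 * real (u * v))
      (2 * (a y * b y + c y * d y * real v)) (2 * (a y * c y + b y * d y * real u))
      (2 * (a y * d y + b y * c y * real g))"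
    unfolding comb_mult by (simp add: power2_eq_square algebra_simps)
  finally have y: "y\<^sup>2 = \<dots>" .
  show ?case
    by (rule bexI[of _ "2 * (a y * c y + b y * d y * real u) + C"],
        rule bexI[of _ "2 * (a y * d y + b y * c y * real g) + D"])
       (use CD Cons.prems(2)[of y] in \<open>auto simp: y IH comb_add\<close>)
qed

text \<open>If some square root of a summand had a nonzero coefficient at \<open>s3\<close>, that coefficient would be
  at least 1/4 in absolute value and the rational part of the sum too large. Hence twice the
  coefficients at \<open>s1\<close> are integers, and \<open>N\<close> is the sum of their squares. The inequality
  says that \<open>\<Sum>(2 a x - \<mu> (2 b x))\<^sup>2 \<ge> 0\<close>.\<close>

lemma sum_of_squares_coefficients:
  assumes xs: "\<And>x. x \<in> set xs \<Longrightarrow> x \<in> combs \<rat> \<and> algebraic_int x"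
    and sum: "(\<Sum>x\<leftarrow>xs. x\<^sup>2) = (A + B * s1) / 2" and rat: "A \<in> \<rat>" "B \<in> \<rat>"
    and small: "8 * A < real (u * v)"
    and sqf: "squarefree (g * u)" "squarefree (u * v)"
    and odd: "odd (g * u)" "odd (u * v)"
  shows "\<exists>N::nat. \<forall>\<mu>. 2 * \<mu> * B \<le> 2 * A - real (g * u) * real N + \<mu>\<^sup>2 * real N"
proof -
  have "\<exists>a b c d. x = comb a b c d \<and> a \<in> \<rat> \<and> b \<in> \<rat> \<and> c \<in> \<rat> \<and> d \<in> \<rat>" if "x \<in> set xs" for x
    using xs[OF that] by (auto simp: combs_def)
  then obtain a b c d where x: "\<And>x. x \<in> set xs \<Longrightarrow> x = comb (a x) (b x) (c x) (d x)"
    and x_rat: "\<And>x. x \<in> set xs \<Longrightarrow> a x \<in> \<rat> \<and> b x \<in> \<rat> \<and> c x \<in> \<rat> \<and> d x \<in> \<rat>"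
    by metis
  have parity: "\<exists>j l :: int. 4 * b x = of_int j \<and> 4 * d x = of_int l \<and> (even j \<longleftrightarrow> even l)"
    if "x \<in> set xs" for x
    using almost_integral_coefficients_parity[OF _ _ _ _ _ sqf odd, of "a x" "b x" "c x" "d x"]
      x[OF that] x_rat[OF that] algebraic_int_imp_almost_integral[of x] xs[OF that] by metis
  define f where "f x = (a x)\<^sup>2 + (b x)\<^sup>2 * real (g * u) + (c x)\<^sup>2 * real (g * v) + (d x)\<^sup>2 * real (u * v)" for x
  define h where "h x = 2 * (a x * b x + c x * d x * real v)" for x
  have f_nonneg: "f x \<ge> 0" for x
    by (simp add: f_def)
  have sum_rat: "(\<Sum>x\<leftarrow>ys. F x) \<in> \<rat>" if "\<And>x. x \<in> set ys \<Longrightarrow> F x \<in> \<rat>" for F :: "real \<Rightarrow> real" and ys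
    using that by (induction ys) auto
  obtain C D where "C \<in> \<rat>" "D \<in> \<rat>" and "(\<Sum>x\<leftarrow>xs. x\<^sup>2) = comb (\<Sum>x\<leftarrow>xs. f x) (\<Sum>x\<leftarrow>xs. h x) C D"
    using sum_list_squares_comb[OF x x_rat] unfolding f_def h_def by blast
  then have "comb (\<Sum>x\<leftarrow>xs. f x) (\<Sum>x\<leftarrow>xs. h x) C D = comb (A / 2) (B / 2) 0 0"
    using sum by (simp add: comb_def add_divide_distrib)
  moreover have "f x \<in> \<rat>" "h x \<in> \<rat>" if "x \<in> set xs" for x
    using x_rat[OF that] by (auto simp: f_def h_def)
  ultimately have f_sum: "(\<Sum>x\<leftarrow>xs. f x) = A / 2" and h_sum: "(\<Sum>x\<leftarrow>xs. h x) = B / 2"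
    using rational_comb_eq_iff sum_rat \<open>C \<in> \<rat>\<close> \<open>D \<in> \<rat>\<close> rat by (simp_all del: of_nat_mult)
  have d0: "d x = 0" if x_in: "x \<in> set xs" for x
  proof (rule ccontr)
    assume "d x \<noteq> 0"
    obtain l :: int where l: "4 * d x = of_int l"
      using parity[OF x_in] by blast
    with \<open>d x \<noteq> 0\<close> have "1 \<le> \<bar>l\<bar>"
      by auto
    then have "1 \<le> \<bar>4 * d x\<bar>"
      unfolding l by linarith
    then have "1 \<le> (4 * d x)\<^sup>2"
      by (simp add: abs_le_square_iff[of 1, simplified])
    then have "1 * real (u * v) \<le> (4 * d x)\<^sup>2 * real (u * v)"
      by (rule mult_right_mono) simp
    also have "\<dots> \<le> 16 * f x"
      by (simp add: f_def power_mult_distrib)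
    also have "f x \<le> (\<Sum>x\<leftarrow>xs. f x)"
      using x_in f_nonneg by (intro member_le_sum_list) auto
    finally show False
      using small f_sum by simp
  qed
  have "\<exists>j::int. 2 * b x = of_int j" if x: "x \<in> set xs" for x
  proof -
    obtain j :: int where "4 * b x = of_int j" "even j"
      using parity[OF x] d0[OF x] by auto
    then show ?thesis
      by (auto elim!: evenE)
  qed
  then obtain e where e: "\<And>x. x \<in> set xs \<Longrightarrow> 2 * b x = of_int (e x)"
    by metis
  define N where "N = (\<Sum>x\<leftarrow>xs. (nat \<bar>e x\<bar>)\<^sup>2)"
  have "real N = (\<Sum>x\<leftarrow>xs. real ((nat \<bar>e x\<bar>)\<^sup>2))"
    unfolding N_def by (induction xs) simp_all
  also have "\<dots> = (\<Sum>x\<leftarrow>xs. (2 * b x)\<^sup>2)"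
    by (intro arg_cong[where f = sum_list] map_cong) (simp_all add: e)
  finally have N: "real N = (\<Sum>x\<leftarrow>xs. (2 * b x)\<^sup>2)" .
  have "2 * \<mu> * B \<le> 2 * A - real (g * u) * real N + \<mu>\<^sup>2 * real N" for \<mu>
  proof -
    have "0 \<le> 4 * f x - 4 * \<mu> * h x - real (g * u) * (2 * b x)\<^sup>2 + \<mu>\<^sup>2 * (2 * b x)\<^sup>2" if "x \<in> set xs" for x
    proof -
      \<comment> \<open>As \<open>d x\<close> vanishes, so does the mixed term with
        \<open>c x\<close>, and the coefficient at \<open>s2\<close> survives only as a nonnegative
        square.\<close>
      have "4 * f x - 4 * \<mu> * h x - real (g * u) * (2 * b x)\<^sup>2 + \<mu>\<^sup>2 * (2 * b x)\<^sup>2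
          = (2 * a x - \<mu> * (2 * b x))\<^sup>2 + real (g * v) * (2 * c x)\<^sup>2"
        using d0[OF that] by (simp add: f_def h_def power2_eq_square algebra_simps)
      then show ?thesis
        by simp
    qed
    then have "0 \<le> (\<Sum>x\<leftarrow>xs. 4 * f x - 4 * \<mu> * h x - real (g * u) * (2 * b x)\<^sup>2 + \<mu>\<^sup>2 * (2 * b x)\<^sup>2)"
      by (intro sum_list_nonneg) auto
    also have "\<dots> = 4 * (\<Sum>x\<leftarrow>xs. f x) - 4 * \<mu> * (\<Sum>x\<leftarrow>xs. h x) - real (g * u) * real N + \<mu>\<^sup>2 * real N"
      unfolding N by (simp only: sum_list_addf sum_list_subtractf sum_list_const_mult)
    finally show ?thesis
      unfolding f_sum h_sum by (simp add: mult_ac)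
  qed
  then show ?thesis
    by blast
qed

end

theorem proposition7p1:
  fixes p q r m t \<kappa> :: nat and K :: "real set"
  assumes "squarefree p" and "squarefree q" and "p \<ge> 2" and "q \<ge> 2"
    and "p mod 4 = 1" and "q mod 4 = 1"
    and "r = p * q div (gcd p q)\<^sup>2"
    and "p < q" and "q < r"
    and "K = biquadratic_field p q"
    and "gcd p q mod 4 = 1 \<or> gcd p q mod 4 = 3"
    and "m > 0" and "t > 0" and "\<kappa> > 0"
  shows
    "(real m \<le> Min {real r / (16 * (real \<kappa> * sqrt (real r) + 1)), real p, real q} \<and>
      sqrt (real p) \<in> I4 m t \<kappa> \<and> sqrt (real q) \<in> I4 m t \<kappa> \<longrightarrow>
        \<not> (\<lambda>\<alpha>. real m * \<alpha>) ` totally_positive_integers K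
             \<subseteq> sums_of_squares (ring_of_integers K)) \<and>
     (real m \<ge> 4 * (real t * (real t - 1)
                 * (2 * real t - 1 + 2 * sqrt (real t * (real t - 1)))) / (real \<kappa>)\<^sup>2 \<longrightarrow>
        I4 m t \<kappa> \<noteq> {})"
proof (intro conjI impI notI)
  assume m: "real m \<le> Min {real r / (16 * (real \<kappa> * sqrt (real r) + 1)), real p, real q} \<and>
      sqrt (real p) \<in> I4 m t \<kappa> \<and> sqrt (real q) \<in> I4 m t \<kappa>"
    and subset: "(\<lambda>\<alpha>. real m * \<alpha>) ` totally_positive_integers K \<subseteq> sums_of_squares (ring_of_integers K)"
  have "p > 1"
    using \<open>p \<ge> 2\<close> by simp
  obtain g u v where p: "p = g * u" and q: "q = g * v" and r: "r = u * v" and "squarefree r"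
    and bq: "biquadratic g u v (sqrt p) (sqrt q) (sqrt r)"
    using biquadratic_sqrt[OF assms(1,2) \<open>p > 1\<close> assms(7,8,9)] by blast
  interpret biquadratic g u v "sqrt p" "sqrt q" "sqrt r"
    by (rule bq)
  have "odd p" "odd q"
    using assms(5,6) by presburger+
  then have "odd r"
    unfolding p q r by simp
  define s where "s = sqrt (real p)"
  have s: "s * s = real p" "s > 0"
    using \<open>p > 1\<close> by (simp_all add: s_def)
  \<comment> \<open>This makes \<kappa> + 2 z the least integer of the parity of
    \<open>\<kappa>\<close> that is at least \<kappa> s; the inequality becomes strict below because
    \<open>s\<close> is irrational.\<close>
  define z where "z = \<lceil>(real \<kappa> * s - real \<kappa>) / 2\<rceil>"
  have "(real \<kappa> * s - real \<kappa>) / 2 \<le> of_int z" "of_int z < (real \<kappa> * s - real \<kappa>) / 2 + 1"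
    unfolding z_def by linarith+
  then have z: "real \<kappa> * s \<le> of_int (int \<kappa> + 2 * z)" "of_int (int \<kappa> + 2 * z) < real \<kappa> * s + 2"
    by (simp_all add: field_simps)
  define c where "c = nat (int \<kappa> + 2 * z)"
  have "real \<kappa> * s > 0"
    using \<open>\<kappa> > 0\<close> s by simp
  with z(1) have c_int: "int c = int \<kappa> + 2 * z"
    unfolding c_def by linarith
  then have c_real: "of_int (int \<kappa> + 2 * z) = real c"
    by (metis of_int_of_nat_eq)
  have c: "real \<kappa> * s \<le> real c" "real c < real \<kappa> * s + 2"
    using z unfolding c_real by simp_all
  have "real \<kappa> * s \<noteq> real c"
  proof
    assume "real \<kappa> * s = real c"
    then have "s = real c / real \<kappa>"
      using \<open>\<kappa> > 0\<close> by (simp add: field_simps)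
    then show False
      using irrational(1) unfolding s_def[symmetric] by simp
  qed
  with c have c_gt: "real \<kappa> * s < real c"
    by simp
  define \<alpha> where "\<alpha> = (real c + real \<kappa> * s) / 2"
  have "\<alpha> \<in> totally_positive_integers K"
    unfolding \<alpha>_def s_def \<open>K = _\<close> using c_gt assms c_int
    by (intro totally_positive_integer_half) (simp_all add: s_def)
  with subset obtain xs where xs: "set xs \<subseteq> ring_of_integers K" "real m * \<alpha> = (\<Sum>x\<leftarrow>xs. x\<^sup>2)"
    unfolding sums_of_squares_def by blast
  have "8 * (real m * real c) < real r"
  proof -
    have m': "real m \<le> real r / (16 * (real \<kappa> * sqrt (real r) + 1))"
      using m by simp
    have "8 * (real m * real c) < 8 * (real m * (real \<kappa> * s + 2))"
      using c(2) \<open>m > 0\<close> by simp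
    also have "\<dots> \<le> 8 * (real m * (2 * (real \<kappa> * sqrt (real r) + 1)))"
    proof -
      have "s \<le> sqrt (real r)"
        using assms(8,9) by (simp add: s_def)
      then have "real \<kappa> * s \<le> real \<kappa> * sqrt (real r)"
        by (intro mult_left_mono) auto
      moreover have "0 \<le> real \<kappa> * sqrt (real r)"
        by simp
      ultimately have "real \<kappa> * s + 2 \<le> 2 * (real \<kappa> * sqrt (real r) + 1)"
        unfolding distrib_left by linarith
      then show ?thesis
        by (intro mult_left_mono) auto
    qed
    also have "\<dots> = real m * (16 * (real \<kappa> * sqrt (real r) + 1))"
      by simp
    also have "\<dots> \<le> real r"
      using m' by (subst (asm) pos_le_divide_eq) (simp_all add: add_nonneg_pos)
    finally show ?thesis .
  qed
  moreover have "(\<Sum>x\<leftarrow>xs. x\<^sup>2) = (real m * real c + real m * real \<kappa> * sqrt p) / 2"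
    using xs(2) by (simp add: \<alpha>_def s_def algebra_simps)
  moreover have "x \<in> combs \<rat> \<and> algebraic_int x" if "x \<in> set xs" for x
    using that xs(1) generate_field_subset_combs
    unfolding ring_of_integers_def \<open>K = _\<close> biquadratic_field_def by blast
  ultimately obtain N :: nat where
    N: "\<And>\<mu>. 2 * \<mu> * (real m * real \<kappa>) \<le> 2 * (real m * real c) - real p * real N + \<mu>\<^sup>2 * real N"
    using sum_of_squares_coefficients[of xs "real m * real c" "real m * real \<kappa>"]
      assms(1) \<open>squarefree r\<close> \<open>odd p\<close> \<open>odd r\<close> unfolding p[symmetric] r[symmetric] by auto
  \<comment> \<open>For \<open>N = 0\<close> the bound would be linear in \<mu>, and \<mu> = c + 1
    already violates it.\<close>
  have "N > 0"
  proof (rule Nat.gr0I)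
    assume "N = 0"
    then have "(2 * real c + 2) * real \<kappa> \<le> 2 * real c"
      using N[of "real c + 1"] \<open>m > 0\<close> by (simp add: mult.left_commute)
    also have "2 * real c < (2 * real c + 2) * 1"
      by simp
    also have "\<dots> \<le> (2 * real c + 2) * real \<kappa>"
      using \<open>\<kappa> > 0\<close> by (intro mult_left_mono) auto
    finally show False
      by simp
  qed
  define M where "M = real m * real \<kappa>"
  \<comment> \<open>The value \<mu> = M / N minimises \<mu>^2 N - 2 \<mu> M, so it is the choice
    that yields the Cauchy-Schwarz inequality.\<close>
  have "2 * (M / real N) * M \<le> 2 * (real m * real c) - real p * real N + (M / real N)\<^sup>2 * real N"
    using N[of "M / real N"] by (simp add: M_def)
  then have "(2 * (M / real N) * M) * real N
      \<le> (2 * (real m * real c) - real p * real N + (M / real N)\<^sup>2 * real N) * real N"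
    by (rule mult_right_mono) simp
  also have "(2 * (M / real N) * M) * real N = 2 * (M * M)"
    using \<open>N > 0\<close> by simp
  also have "(2 * (real m * real c) - real p * real N + (M / real N)\<^sup>2 * real N) * real N
      = 2 * (real m * real c) * real N - s * s * real N * real N + (M / real N * real N)\<^sup>2"
    unfolding s(1) by (simp only: power2_eq_square algebra_simps)
  also have "M / real N * real N = M"
    using \<open>N > 0\<close> by simp
  finally have "M * M \<le> 2 * (real m * real c) * real N - s * s * real N * real N"
    by (simp add: power2_eq_square)
  \<comment> \<open>Subtracting 2 s N M from both sides completes the square on the left and leaves
    the small factor c - \<kappa> s on the right.\<close>
  then have "(s * real N - M)\<^sup>2 \<le> 2 * real m * real N * (real c - real \<kappa> * s)"
    by (simp add: power2_eq_square algebra_simps M_def)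
  also have "\<dots> < 2 * real m * real N * 2"
    using c(2) \<open>m > 0\<close> \<open>N > 0\<close> by (intro mult_strict_left_mono) auto
  finally have "(s * real N - real m * real \<kappa>)\<^sup>2 < 4 * real m * real N"
    by (simp add: M_def)
  then show False
    using I4_not_near_quotient[of s m t \<kappa> N] m assms unfolding s_def by simp
next
  assume "real m \<ge> 4 * (real t * (real t - 1)
      * (2 * real t - 1 + 2 * sqrt (real t * (real t - 1)))) / (real \<kappa>)\<^sup>2" and "I4 m t \<kappa> = {}"
  then show False
    using I4_nonempty[OF assms(12-14)] by blast
qed

end
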